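(* For all sufficiently large $n$, \[ \frac{n}{12}\le wt(n)\le \frac{n}{2}-\Omega(n^{1/3}), \] i.e., every permutation of $[n]$ contains weak twins of length at least $n/12$, and there is a constant $c>0$ such that for all large $n$ there exists a permutation of $[n]$ containing no weak twins of length greater than $n/2-cn^{1/3}$.
   Context: A permutation is a finite sequence of distinct positive integers; an $n$-permutation is a permutation of $[n]=\{1,\dots,n\}$. The shape of a permutation $(x_1,\dots,x_w)$ is the sequence $(s_1,\dots,s_{w-1})\in\{+,-\}^{w-1}$ with $s_i=+$ iff $x_i<x_{i+1}$. Two permutations of the same length are weakly similar if they have the same shape. A sub-permutation of $\pi$ is a subsequence $(\pi(i_1),\dots,\pi(i_j))$ with $i_1<\dots<i_j$. Weak twins in $\pi$ are two disjoint (no common positions) weakly similar sub-permutations of $\pi$; their length is the length of one of them. $wt(\pi)$ is the largest $w$ such that $\pi$ contains weak twins of length $w$, and $wt(n)$ is the minimum of $wt(\pi)$ over all $n$-permutations $\pi$. *)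

theory Defs
  imports Complex_Main "HOL-Combinatorics.Multiset_Permutations"
begin

text \<open>
  Permutations are lists of natural numbers, so positions are counted from 0;
  the n-permutations are the elements of \<^term>\<open>permutations_of_set {1..n::nat}\<close>.
  In a shape, \<^term>\<open>True\<close> stands for the sign + and \<^term>\<open>False\<close> for the sign -.
\<close>

definition shape :: "nat list \<Rightarrow> bool list" where
  "shape xs = map (\<lambda>i. xs ! i < xs ! Suc i) [0..<length xs - 1]"

text \<open>The length condition is not redundant: lengths 0 and 1 both have the empty shape.\<close>

definition weakly_similar :: "nat list \<Rightarrow> nat list \<Rightarrow> bool" where
  "weakly_similar xs ys \<longleftrightarrow> length xs = length ys \<and> shape xs = shape ys"

text \<open>
  A sub-permutation is given by its set of positions \<open>I\<close>;
  the sequence itself is \<^term>\<open>nths p I\<close>.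
\<close>

definition weak_twins :: "nat list \<Rightarrow> nat set \<Rightarrow> nat set \<Rightarrow> bool" where
  "weak_twins p I J \<longleftrightarrow>
     I \<subseteq> {..<length p} \<and> J \<subseteq> {..<length p} \<and> I \<inter> J = {} \<and>
     weakly_similar (nths p I) (nths p J)"

definition has_weak_twins :: "nat list \<Rightarrow> nat \<Rightarrow> bool" where
  "has_weak_twins p w \<longleftrightarrow> (\<exists>I J. weak_twins p I J \<and> length (nths p I) = w)"

definition wt_perm :: "nat list \<Rightarrow> nat" where
  "wt_perm p = Max {w. has_weak_twins p w}"

definition wt :: "nat \<Rightarrow> nat" where
  "wt n = Min (wt_perm ` permutations_of_set {1..n})"

text \<open>The maximum and the minimum are taken over finite nonempty sets.\<close>

lemma has_weak_twins_0: "has_weak_twins p 0"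
  unfolding has_weak_twins_def weak_twins_def weakly_similar_def
  by (intro exI[of _ "{}"]) auto

lemma has_weak_twins_le_length: "has_weak_twins p w \<Longrightarrow> w \<le> length p"
proof -
  have "card {i. i < length p \<and> i \<in> I} \<le> card {..<length p}" for I
    by (rule card_mono) auto
  then show "has_weak_twins p w \<Longrightarrow> w \<le> length p"
    by (auto simp: has_weak_twins_def length_nths)
qed

lemma finite_has_weak_twins: "finite {w. has_weak_twins p w}"
  by (rule finite_subset[of _ "{..length p}"]) (auto dest: has_weak_twins_le_length)

lemma wt_perm_ge_iff: "w \<le> wt_perm p \<longleftrightarrow> (\<exists>v\<ge>w. has_weak_twins p v)"
  unfolding wt_perm_def using has_weak_twins_0
  by (subst Max_ge_iff[OF finite_has_weak_twins]) auto

lemma wt_perm_le_iff: "wt_perm p \<le> w \<longleftrightarrow> (\<forall>v. has_weak_twins p v \<longrightarrow> v \<le> w)"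
  unfolding wt_perm_def using has_weak_twins_0
  by (subst Max_le_iff[OF finite_has_weak_twins]) auto

lemma wt_ge_iff: "w \<le> wt n \<longleftrightarrow> (\<forall>p\<in>permutations_of_set {1..n}. w \<le> wt_perm p)"
  unfolding wt_def by (subst Min_ge_iff) auto

lemma wt_le_iff: "wt n \<le> w \<longleftrightarrow> (\<exists>p\<in>permutations_of_set {1..n}. wt_perm p \<le> w)"
  unfolding wt_def by (subst Min_le_iff) auto

end

theory Submission
  imports Defs
begin

text \<open>
  Lower bound. Let the first twin consist of the smaller and the second of the larger ends of a
  sequence of value intervals spanned by pairs from consecutive blocks of positions. The shapes
  agree as soon as no two consecutive intervals are nested. Keep two admissible choices for the
  last interval, with disjoint interiors: a new interval is then nested with both only if it
  contains both. Of the three consecutive intervals spanned by four new values at most one does, so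
  two with disjoint interiors survive. Hence every four positions extend the twins by one.

  Upper bound. Arrange increasing blocks such that every value of a block exceeds all values of the
  later blocks; a shape then records the sizes of the nonempty intersections with the blocks. If the
  \<open>k\<close>-th elements of both twins always lie in the same block, each block of odd length loses an
  element. Otherwise, at the first disagreement, one twin has to fit its part of a block into a
  later block while the other twin misses the former; with block lengths decreasing by at least
  \<open>m\<close> this costs \<open>m\<close> elements. Using \<open>m\<close> odd blocks with gaps about \<open>m\<close> takes about \<open>m ^ 3\<close> elements.
\<close>

section \<open>Twins as pairs of increasing position maps\<close>

text \<open>The bound \<open>N\<close> confines both twins to an initial segment of positions, so
  that they can be lengthened beyond it while \<open>p\<close> stays fixed.\<close>

definition twin_maps :: "nat list \<Rightarrow> nat \<Rightarrow> nat \<Rightarrow> (nat \<Rightarrow> nat) \<Rightarrow> (nat \<Rightarrow> nat) \<Rightarrow> bool" where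
  "twin_maps p N w f g \<longleftrightarrow>
     strict_mono_on {..<w} f \<and> strict_mono_on {..<w} g \<and>
     f ` {..<w} \<subseteq> {..<N} \<and> g ` {..<w} \<subseteq> {..<N} \<and> f ` {..<w} \<inter> g ` {..<w} = {} \<and>
     (\<forall>k. Suc k < w \<longrightarrow> (p ! f k < p ! f (Suc k) \<longleftrightarrow> p ! g k < p ! g (Suc k)))"

lemma nths_conv_map_nth: "nths xs I = map ((!) xs) (filter (\<lambda>i. i \<in> I) [0..<length xs])"
proof -
  have "zip xs [0..<length xs] = map (\<lambda>i. (xs ! i, i)) [0..<length xs]"
    by (rule nth_equalityI) auto
  then show ?thesis
    by (simp add: nths_def filter_map o_def)
qed

lemma filter_upt_image_strict_mono:
  fixes f :: "nat \<Rightarrow> nat"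
  assumes "strict_mono_on {..<w} f" "f ` {..<w} \<subseteq> {..<n}"
  shows "filter (\<lambda>i. i \<in> f ` {..<w}) [0..<n] = map f [0..<w]"
proof (rule sorted_distinct_set_unique)
  show "sorted (map f [0..<w])"
    using assms(1) by (auto simp: sorted_iff_nth_mono_less strict_mono_on_def intro!: less_imp_le)
  show "distinct (map f [0..<w])"
    using strict_mono_on_imp_inj_on[OF assms(1)] by (simp add: distinct_map atLeast0LessThan)
  show "set (filter (\<lambda>i. i \<in> f ` {..<w}) [0..<n]) = set (map f [0..<w])"
    using assms(2) by (auto simp: image_subset_iff)
qed (auto intro: sorted_wrt_filter)

lemma shape_map: "shape (map h [0..<w]) = map (\<lambda>i. h i < h (Suc i)) [0..<w - 1]"
  by (auto simp: shape_def)

text \<open>The maps are the increasing enumerations of the two position sets, and these sets are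
  the images of the maps. With maps the \<open>k\<close>-th elements of the two twins can be
  compared directly.\<close>

lemma has_weak_twins_iff: "has_weak_twins p w \<longleftrightarrow> (\<exists>f g. twin_maps p (length p) w f g)"
proof
  assume "has_weak_twins p w"
  then obtain I J where IJ: "I \<inter> J = {}"
    "length (nths p I) = w" "length (nths p J) = w" "shape (nths p I) = shape (nths p J)"
    by (auto simp: has_weak_twins_def weak_twins_def weakly_similar_def)
  define ps qs where "ps = filter (\<lambda>i. i \<in> I) [0..<length p]"
    and "qs = filter (\<lambda>i. i \<in> J) [0..<length p]"
  have len: "length ps = w" "length qs = w"
    using IJ(2,3) by (simp_all add: nths_conv_map_nth ps_def qs_def)
  have range: "(!) ps ` {..<w} = set ps" "(!) qs ` {..<w} = set qs"
    using len by (auto simp: in_set_conv_nth image_def)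
  have sets: "set ps = I \<inter> {..<length p}" "set qs = J \<inter> {..<length p}"
    by (auto simp: ps_def qs_def)
  have "sorted_wrt (<) ps" "sorted_wrt (<) qs"
    by (simp_all add: ps_def qs_def sorted_wrt_filter)
  then have mono: "strict_mono_on {..<w} ((!) ps)" "strict_mono_on {..<w} ((!) qs)"
    using len by (auto simp: strict_mono_on_def sorted_wrt_iff_nth_less)
  have shape: "p ! (ps ! k) < p ! (ps ! Suc k) \<longleftrightarrow> p ! (qs ! k) < p ! (qs ! Suc k)"
    if "Suc k < w" for k
  proof -
    have "shape (nths p I) ! k = shape (nths p J) ! k" "k < w - 1"
      using IJ(4) that by simp_all
    then show ?thesis
      using len that by (simp add: nths_conv_map_nth shape_def flip: ps_def qs_def)
  qed
  show "\<exists>f g. twin_maps p (length p) w f g"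
  proof (intro exI)
    show "twin_maps p (length p) w ((!) ps) ((!) qs)"
      unfolding twin_maps_def range sets using IJ(1) mono shape by auto
  qed
next
  assume "\<exists>f g. twin_maps p (length p) w f g"
  then obtain f g where fg: "twin_maps p (length p) w f g"
    by blast
  define I J where "I = f ` {..<w}" and "J = g ` {..<w}"
  have "nths p I = map (\<lambda>k. p ! f k) [0..<w]" "nths p J = map (\<lambda>k. p ! g k) [0..<w]"
    using fg by (simp_all add: nths_conv_map_nth I_def J_def filter_upt_image_strict_mono twin_maps_def)
  with fg have "weak_twins p I J \<and> length (nths p I) = w"
    by (simp add: weak_twins_def weakly_similar_def shape_map) (auto simp: twin_maps_def I_def J_def)
  then show "has_weak_twins p w"
    unfolding has_weak_twins_def by blast
qed

subsection \<open>Lower bound\<close>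

text \<open>Positions from \<open>N\<close> on exceed all earlier ones, so monotonicity and
  disjointness come for free; only the last sign has to be matched.\<close>

lemma twin_maps_extend:
  assumes "twin_maps p N (Suc k) f g"
    and "N \<le> x" "N \<le> y" "x < N'" "y < N'" "x \<noteq> y"
    and "p ! f k < p ! x \<longleftrightarrow> p ! g k < p ! y"
  shows "twin_maps p N' (Suc (Suc k)) (f(Suc k := x)) (g(Suc k := y))"
proof -
  have lt: "f i < N" "g i < N" if "i \<le> k" for i
    using assms(1) that by (auto simp: twin_maps_def image_subset_iff)
  have image: "f(Suc k := x) ` {..<Suc (Suc k)} = insert x (f ` {..<Suc k})"
    "g(Suc k := y) ` {..<Suc (Suc k)} = insert y (g ` {..<Suc k})"
    by (auto simp: lessThan_Suc)
  have mono: "strict_mono_on {..<Suc (Suc k)} (h(Suc k := z))"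
    if "strict_mono_on {..<Suc k} h" "\<And>i. i \<le> k \<Longrightarrow> h i < z" for h :: "nat \<Rightarrow> nat" and z
    using that by (auto simp: strict_mono_on_def less_Suc_eq_le le_Suc_eq)
  show ?thesis
    unfolding twin_maps_def image
  proof (intro conjI)
    show "strict_mono_on {..<Suc (Suc k)} (f(Suc k := x))"
      by (rule mono) (use assms lt in \<open>auto simp: twin_maps_def intro: less_le_trans\<close>)
    show "strict_mono_on {..<Suc (Suc k)} (g(Suc k := y))"
      by (rule mono) (use assms lt in \<open>auto simp: twin_maps_def intro: less_le_trans\<close>)
    show "insert x (f ` {..<Suc k}) \<subseteq> {..<N'}" "insert y (g ` {..<Suc k}) \<subseteq> {..<N'}"
      using lt assms(2-5) by (fastforce simp: less_Suc_eq_le)+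
    have "x \<notin> g ` {..<Suc k}" "y \<notin> f ` {..<Suc k}"
      using lt assms(2,3) by (fastforce simp: less_Suc_eq_le)+
    then show "insert x (f ` {..<Suc k}) \<inter> insert y (g ` {..<Suc k}) = {}"
      using assms(1,6) by (auto simp: twin_maps_def)
    show "\<forall>i. Suc i < Suc (Suc k) \<longrightarrow>
        (p ! (f(Suc k := x)) i < p ! (f(Suc k := x)) (Suc i) \<longleftrightarrow>
         p ! (g(Suc k := y)) i < p ! (g(Suc k := y)) (Suc i))"
      using assms(1,7) by (auto simp: twin_maps_def less_Suc_eq)
  qed
qed

lemma obtain_four_increasing:
  fixes p :: "nat list"
  assumes "distinct p" "N + 4 \<le> length p"
  obtains a b c d where "{a, b, c, d} \<subseteq> {N..<N + 4}" "p ! a < p ! b" "p ! b < p ! c" "p ! c < p ! d"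
proof -
  define V where "V = (!) p ` {N..<N + 4}"
  have "card V = 4"
    unfolding V_def using assms
    by (subst card_image) (auto simp: inj_on_def nth_eq_iff_index_eq)
  define vs where "vs = sorted_list_of_set V"
  have len: "length vs = 4" and set: "set vs = V" and sorted: "sorted_wrt (<) vs"
    using \<open>card V = 4\<close> by (simp_all add: vs_def V_def)
  have "\<exists>i\<in>{N..<N + 4}. vs ! k = p ! i" if "k < 4" for k
    using nth_mem[of k vs] that len set by (auto simp: V_def)
  then obtain pos where pos: "\<And>k. k < 4 \<Longrightarrow> pos k \<in> {N..<N + 4} \<and> vs ! k = p ! pos k"
    by metis
  have "p ! pos i < p ! pos j" if "i < j" "j < 4" for i j
    using sorted_wrt_nth_less[OF sorted, of i j] that len pos by auto
  then show thesis
    using pos by (intro that[of "pos 0" "pos 1" "pos 2" "pos 3"]) auto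
qed

text \<open>An equivalence fails only if one of its two intervals contains the other. An interval
  inside one of the two old intervals lies on one side of the other old one; so if both equivalences
  failed, the new interval would contain both old ones, which the last assumption excludes.\<close>

lemma interval_not_nested_with_one_of_two:
  fixes u :: "'a::linorder"
  assumes "u < v" "v \<le> u'" "u' < v'" "x < y" "{x, y} \<inter> {u, v, u', v'} = {}"
    and "\<not> (x < u \<and> v' < y)"
  shows "(u < x \<longleftrightarrow> v < y) \<or> (u' < x \<longleftrightarrow> v' < y)"
  using assms by (cases x u rule: linorder_cases; cases v' y rule: linorder_cases) auto

text \<open>The two pairs of twins are alternatives, of which only one gets extended, so they may
  share positions. The non-strict inequality admits final intervals with a common end, such as those
  from \<open>a\<close> to \<open>b\<close> and from \<open>b\<close> to \<open>c\<close>.\<close>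

lemma twin_maps_two_ends:
  assumes "distinct p" "4 * Suc k \<le> length p"
  shows "\<exists>f g f' g'. twin_maps p (4 * Suc k) (Suc k) f g \<and> twin_maps p (4 * Suc k) (Suc k) f' g' \<and>
    p ! f k < p ! g k \<and> p ! g k \<le> p ! f' k \<and> p ! f' k < p ! g' k"
  using assms(2)
proof (induction k)
  case 0
  then have "0 + 4 \<le> length p" by simp
  from obtain_four_increasing[OF assms(1) this]
  obtain a b c d where abcd: "{a, b, c, d} \<subseteq> {0..<0 + 4}"
    "p ! a < p ! b" "p ! b < p ! c" "p ! c < p ! d" .
  have "twin_maps p 4 (Suc 0) (\<lambda>_. x) (\<lambda>_. y)" if "x < 4" "y < 4" "x \<noteq> y" for x y
    using that by (auto simp: twin_maps_def strict_mono_on_def)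
  from this[of a b] this[of b c] abcd show ?case
    by (intro exI[of _ "\<lambda>_. a"] exI[of _ "\<lambda>_. b"] exI[of _ "\<lambda>_. c"]) auto
next
  case (Suc k)
  define N where "N = 4 * Suc k"
  have N: "N + 4 \<le> length p" "4 * Suc (Suc k) = N + 4"
    using Suc.prems by (simp_all add: N_def)
  obtain f g f' g' where fg: "twin_maps p N (Suc k) f g" "twin_maps p N (Suc k) f' g'"
    "p ! f k < p ! g k" "p ! g k \<le> p ! f' k" "p ! f' k < p ! g' k"
    using Suc.IH Suc.prems unfolding N_def by auto
  obtain a b c d where abcd: "{a, b, c, d} \<subseteq> {N..<N + 4}"
    "p ! a < p ! b" "p ! b < p ! c" "p ! c < p ! d"
    using obtain_four_increasing[OF assms(1) N(1)] .
  have lt: "f k < N" "g k < N" "f' k < N" "g' k < N"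
    using fg(1,2) by (auto simp: twin_maps_def image_subset_iff)
  \<comment> \<open>This hides which of the two old pairs was extended.\<close>
  define reach where "reach x y \<longleftrightarrow> (\<exists>f g. twin_maps p (N + 4) (Suc (Suc k)) f g \<and>
    f (Suc k) = x \<and> g (Suc k) = y)" for x y
  have reachI: "reach x y"
    if xy: "x \<in> {N..<N + 4}" "y \<in> {N..<N + 4}" "p ! x < p ! y"
      and "\<not> (p ! x < p ! f k \<and> p ! g' k < p ! y)" for x y
  proof -
    have "{p ! x, p ! y} \<inter> {p ! f k, p ! g k, p ! f' k, p ! g' k} = {}"
      using assms(1) N(1) lt xy(1,2) by (auto simp: nth_eq_iff_index_eq)
    from interval_not_nested_with_one_of_two[OF fg(3-5) xy(3) this that(4)]
    consider "p ! f k < p ! x \<longleftrightarrow> p ! g k < p ! y" | "p ! f' k < p ! x \<longleftrightarrow> p ! g' k < p ! y"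
      by blast
    then show ?thesis
    proof cases
      case 1
      have "twin_maps p (N + 4) (Suc (Suc k)) (f(Suc k := x)) (g(Suc k := y))"
        by (rule twin_maps_extend[OF fg(1)]) (use xy 1 in auto)
      then show ?thesis
        unfolding reach_def by (metis fun_upd_same)
    next
      case 2
      have "twin_maps p (N + 4) (Suc (Suc k)) (f'(Suc k := x)) (g'(Suc k := y))"
        by (rule twin_maps_extend[OF fg(2)]) (use xy 2 in auto)
      then show ?thesis
        unfolding reach_def by (metis fun_upd_same)
    qed
  qed
  have "\<exists>x y x' y'. reach x y \<and> reach x' y' \<and> p ! x < p ! y \<and> p ! y \<le> p ! x' \<and> p ! x' < p ! y'"
  proof -
    \<comment> \<open>Of the intervals between consecutive new values, at most one contains
      everything from \<open>p ! f k\<close> to \<open>p ! g' k\<close>; the cases list two that do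
      not.\<close>
    consider "\<not> (p ! a < p ! f k \<and> p ! g' k < p ! b)" "\<not> (p ! b < p ! f k \<and> p ! g' k < p ! c)"
      | "\<not> (p ! a < p ! f k \<and> p ! g' k < p ! b)" "\<not> (p ! c < p ! f k \<and> p ! g' k < p ! d)"
      | "\<not> (p ! b < p ! f k \<and> p ! g' k < p ! c)" "\<not> (p ! c < p ! f k \<and> p ! g' k < p ! d)"
      using fg(3-5) abcd(2-4) by (cases "p ! b < p ! f k"; cases "p ! c < p ! f k") auto
    then show ?thesis
    proof cases
      case 1
      with abcd have "reach a b" "reach b c" by (auto intro: reachI)
      with abcd show ?thesis by blast
    next
      case 2
      with abcd have "reach a b" "reach c d" by (auto intro: reachI)
      with abcd show ?thesis by (blast intro: less_imp_le)
    next
      case 3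
      with abcd have "reach b c" "reach c d" by (auto intro: reachI)
      with abcd show ?thesis by blast
    qed
  qed
  then show ?case
    unfolding reach_def N(2) by metis
qed

lemma wt_ge_div_4: "n div 4 \<le> wt n"
proof (cases "n div 4")
  case (Suc k)
  show ?thesis
    unfolding wt_ge_iff
  proof
    fix p assume "p \<in> permutations_of_set {1..n}"
    then have p: "distinct p" "length p = n"
      by (auto simp: permutations_of_set_def distinct_card[symmetric])
    have le: "4 * Suc k \<le> length p"
      using times_div_less_eq_dividend[of 4 n] by (simp add: Suc p(2))
    from twin_maps_two_ends[OF p(1) this]
    obtain f g where "twin_maps p (4 * Suc k) (Suc k) f g"
      by blast
    with le have "twin_maps p (length p) (Suc k) f g"
      unfolding twin_maps_def by (meson lessThan_subset_iff subset_trans)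
    then show "n div 4 \<le> wt_perm p"
      using Suc has_weak_twins_iff wt_perm_ge_iff by auto
  qed
qed simp

subsection \<open>Upper bound\<close>

text \<open>Induction on the number of blocks: a new first block receives the largest values in
  increasing order, and the old blocks are renumbered by one.\<close>

lemma block_permutation_exists:
  "\<exists>p\<in>permutations_of_set {1..sum_list Ls}. \<exists>blk :: nat \<Rightarrow> nat.
     (\<forall>i<sum_list Ls. blk i < length Ls) \<and>
     (\<forall>i j. i < j \<longrightarrow> j < sum_list Ls \<longrightarrow>
        blk i \<le> blk j \<and> (p ! i < p ! j \<longleftrightarrow> blk i = blk j)) \<and>
     (\<forall>b<length Ls. card {i. i < sum_list Ls \<and> blk i = b} = Ls ! b)"
proof (induction Ls)
  case Nil
  show ?case by simp
next
  case (Cons L Ls)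
  define s where "s = sum_list Ls"
  from Cons.IH obtain p blk where p: "p \<in> permutations_of_set {1..s}"
    and blk: "\<And>i. i < s \<Longrightarrow> blk i < length Ls"
    "\<And>i j. i < j \<Longrightarrow> j < s \<Longrightarrow> blk i \<le> blk j \<and> (p ! i < p ! j \<longleftrightarrow> blk i = blk j)"
    "\<And>b. b < length Ls \<Longrightarrow> card {i. i < s \<and> blk i = b} = Ls ! b"
    unfolding s_def by blast
  have len: "length p = s" and set: "set p = {1..s}" and dist: "distinct p"
    using p by (auto simp: permutations_of_set_def distinct_card[symmetric])
  define q where "q = [s + 1..<s + L + 1] @ p"
  define blk' where "blk' i = (if i < L then 0 else Suc (blk (i - L)))" for i
  have sum: "sum_list (L # Ls) = L + s"
    by (simp add: s_def)
  have "q \<in> permutations_of_set {1..L + s}"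
    using set dist by (auto simp: q_def permutations_of_set_def)
  moreover have "blk' i < length (L # Ls)" if "i < L + s" for i
    using that blk(1)[of "i - L"] by (auto simp: blk'_def)
  moreover have "blk' i \<le> blk' j \<and> (q ! i < q ! j \<longleftrightarrow> blk' i = blk' j)"
    if "i < j" "j < L + s" for i j
  proof (cases "L \<le> j")
    case True
    then have "p ! (j - L) \<in> set p"
      using that len by auto
    then have "p ! (j - L) \<le> s"
      unfolding set by simp
    then show ?thesis
      using that True blk(2)[of "i - L" "j - L"]
      by (auto simp: q_def blk'_def nth_append simp del: upt_Suc)
  next
    case False
    then show ?thesis
      using that by (auto simp: q_def blk'_def nth_append)
  qed
  moreover have "card {i. i < L + s \<and> blk' i = b} = (L # Ls) ! b" if "b < length (L # Ls)" for b
  proof (cases b)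
    case 0
    then have "{i. i < L + s \<and> blk' i = b} = {..<L}"
      by (auto simp: blk'_def)
    with 0 show ?thesis by simp
  next
    case (Suc b')
    have "{i. i < L + s \<and> blk' i = b} = (+) L ` {i. i < s \<and> blk i = b'}"
    proof (intro set_eqI iffI)
      fix i assume "i \<in> {i. i < L + s \<and> blk' i = b}"
      then show "i \<in> (+) L ` {i. i < s \<and> blk i = b'}"
        using Suc by (intro image_eqI[of _ _ "i - L"]) (auto simp: blk'_def split: if_splits)
    qed (auto simp: blk'_def Suc)
    with Suc that blk(3)[of b'] show ?thesis
      by (simp add: card_image)
  qed
  ultimately show ?case
    unfolding sum by blast
qed

text \<open>Here \<open>bf k\<close> and \<open>bg k\<close> are the blocks of the
  \<open>k\<close>-th elements, and \<open>steps\<close> expresses equality of shapes. The loss of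
  \<open>m\<close> is either one element in each of \<open>m\<close> odd blocks or \<open>m\<close>
  elements in a single block. Block 0 may have any parity, so that it can later absorb the remaining
  elements.\<close>

lemma block_counts_bound:
  fixes bf bg :: "nat \<Rightarrow> nat" and L :: "nat \<Rightarrow> nat"
  assumes mono: "\<And>k l. k \<le> l \<Longrightarrow> l < w \<Longrightarrow> bf k \<le> bf l" "\<And>k l. k \<le> l \<Longrightarrow> l < w \<Longrightarrow> bg k \<le> bg l"
    and range: "\<And>k. k < w \<Longrightarrow> bf k \<le> m" "\<And>k. k < w \<Longrightarrow> bg k \<le> m"
    and steps: "\<And>k. Suc k < w \<Longrightarrow> bf k = bf (Suc k) \<longleftrightarrow> bg k = bg (Suc k)"
    and counts: "\<And>b. b \<le> m \<Longrightarrow> card {k. k < w \<and> bf k = b} + card {k. k < w \<and> bg k = b} \<le> L b"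
    and odd: "\<And>b. 0 < b \<Longrightarrow> b \<le> m \<Longrightarrow> odd (L b)"
    and gap: "\<And>b b'. b < b' \<Longrightarrow> b' \<le> m \<Longrightarrow> L b' + m \<le> L b"
  shows "2 * w + m \<le> (\<Sum>b\<le>m. L b)"
proof -
  define cf cg where "cf b = card {k. k < w \<and> bf k = b}" and "cg b = card {k. k < w \<and> bg k = b}" for b
  have total: "w = (\<Sum>b\<le>m. card {k. k < w \<and> h k = b})" if "\<And>k. k < w \<Longrightarrow> h k \<le> m" for h :: "nat \<Rightarrow> nat"
  proof -
    have "{..<w} = (\<Union>b\<le>m. {k. k < w \<and> h k = b})"
      using that by auto
    then have "w = card (\<Union>b\<le>m. {k. k < w \<and> h k = b})"
      by (metis card_lessThan)
    then show ?thesis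
      by (subst (asm) card_UN_disjoint) auto
  qed
  have two_w: "2 * w = (\<Sum>b\<le>m. cf b + cg b)"
    using total[OF range(1)] total[OF range(2)] by (simp add: sum.distrib cf_def cg_def)
  \<comment> \<open>By monotonicity, two elements share a block iff no step between them changes the
    block; hence both twins split into the same runs of indices.\<close>
  have same: "bf k = bf l \<longleftrightarrow> bg k = bg l" if "k \<le> l" "l < w" for k l
    using that
  proof (induction l rule: dec_induct)
    case (step l)
    have "bf k \<le> bf l" "bf l \<le> bf (Suc l)" "bg k \<le> bg l" "bg l \<le> bg (Suc l)"
      using mono step.hyps step.prems by auto
    then show ?case
      using step.IH step.prems steps[of l] by auto
  qed simp
  have same': "bf k = bf l \<longleftrightarrow> bg k = bg l" if "k < w" "l < w" for k l
    using same[of k l] same[of l k] that by (cases "k \<le> l") auto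
  show ?thesis
  proof (cases "\<forall>k<w. bf k = bg k")
    case True
    then have eq: "cf b = cg b" for b
      unfolding cf_def cg_def by (intro arg_cong[where f = card]) auto
    \<comment> \<open>Equal counts have an even sum, which cannot fill a block of odd
      length.\<close>
    have "cf b + cg b + (if b = 0 then 0 else 1) \<le> L b" if "b \<le> m" for b
    proof (cases "b = 0")
      case False
      with odd[of b] that have "cf b + cg b \<noteq> L b"
        unfolding eq by (metis gr0I mult_2 dvd_triv_left)
      with counts[OF that] False show ?thesis
        by (simp add: cf_def cg_def)
    qed (use counts[OF that] in \<open>simp add: cf_def cg_def\<close>)
    then have "(\<Sum>b\<le>m. cf b + cg b + (if b = 0 then 0 else 1)) \<le> (\<Sum>b\<le>m. L b)"
      by (intro sum_mono) auto
    moreover have "(\<Sum>b\<le>m. (if b = 0 then 0 else 1 :: nat)) = m"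
      by (induction m) auto
    ultimately show ?thesis
      by (simp add: two_w sum.distrib)
  next
    case False
    define k where "k = (LEAST k. k < w \<and> bf k \<noteq> bg k)"
    have k: "k < w" "bf k \<noteq> bg k"
      using LeastI_ex[of "\<lambda>k. k < w \<and> bf k \<noteq> bg k"] False by (auto simp: k_def)
    have before: "bf l = bg l" if "l < k" for l
      using not_less_Least[of l "\<lambda>k. k < w \<and> bf k \<noteq> bg k"] that k(1) by (auto simp: k_def)
    \<comment> \<open>The run containing \<open>k\<close> is common to both twins, so its size is
      bounded by the length of either block.\<close>
    have class_eq: "{l. l < w \<and> bf l = bf k} = {l. l < w \<and> bg l = bg k}"
      using same' k(1) by auto
    have "\<exists>b\<le>m. cf b + cg b + m \<le> L b"
    proof (cases "bf k < bg k")
      case True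
      \<comment> \<open>The second twin misses block \<open>bf k\<close>: before \<open>k\<close>
        the blocks agree, so a hit would put \<open>l\<close> and \<open>k\<close> in one run and
        force \<open>bg k = bf k\<close>; from \<open>k\<close> on, the blocks are at least
        \<open>bg k\<close>.\<close>
      have "bg l \<noteq> bf k" if "l < w" for l
        using before[of l] same'[of l k] mono(2)[of k l] True k(1) that
        by (cases "l < k") auto
      then have "cg (bf k) = 0"
        by (auto simp: cg_def)
      moreover have "cf (bf k) \<le> L (bg k)"
        using counts[of "bg k"] range(2) k(1) by (auto simp: cf_def class_eq)
      moreover have "L (bg k) + m \<le> L (bf k)"
        using gap True range(2) k(1) by auto
      ultimately show ?thesis
        using range(1)[OF k(1)] by (intro exI[of _ "bf k"]) auto
    next
      case False
      with k have less: "bg k < bf k" by simp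
      have "bf l \<noteq> bg k" if "l < w" for l
        using before[of l] same'[of l k] mono(1)[of k l] less k(1) that
        by (cases "l < k") auto
      then have "cf (bg k) = 0"
        by (auto simp: cf_def)
      moreover have "cg (bg k) \<le> L (bf k)"
        using counts[of "bf k"] range(1) k(1) by (auto simp: cg_def simp flip: class_eq)
      moreover have "L (bf k) + m \<le> L (bg k)"
        using gap less range(1) k(1) by auto
      ultimately show ?thesis
        using range(2)[OF k(1)] by (intro exI[of _ "bg k"]) auto
    qed
    then obtain b where b: "b \<le> m" "cf b + cg b + m \<le> L b" by blast
    have "(\<Sum>i\<in>{..m} - {b}. cf i + cg i) \<le> (\<Sum>i\<in>{..m} - {b}. L i)"
      using counts by (intro sum_mono) (auto simp: cf_def cg_def)
    then show ?thesis
      using b by (simp add: two_w sum.remove[of "{..m}" b])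
  qed
qed

lemma wt_le_of_block_lengths:
  assumes odd: "\<And>b. 0 < b \<Longrightarrow> b \<le> m \<Longrightarrow> odd (L b)"
    and gap: "\<And>b b'. b < b' \<Longrightarrow> b' \<le> m \<Longrightarrow> L b' + m \<le> L b"
  shows "2 * wt (\<Sum>b\<le>m. L b) + m \<le> (\<Sum>b\<le>m. L b)"
proof -
  define n where "n = (\<Sum>b\<le>m. L b)"
  define Ls where "Ls = map L [0..<Suc m]"
  have sum: "sum_list Ls = n"
    unfolding Ls_def n_def interv_sum_list_conv_sum_set_nat
    by (simp only: set_upt atLeast0LessThan lessThan_Suc_atMost)
  obtain p blk where p: "p \<in> permutations_of_set {1..n}"
    and blk: "\<And>i. i < n \<Longrightarrow> blk i \<le> m"
    "\<And>i j. i < j \<Longrightarrow> j < n \<Longrightarrow> blk i \<le> blk j \<and> (p ! i < p ! j \<longleftrightarrow> blk i = blk j)"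
    "\<And>b. b \<le> m \<Longrightarrow> card {i. i < n \<and> blk i = b} = L b"
    using block_permutation_exists[of Ls] unfolding sum
    by (auto simp: Ls_def less_Suc_eq_le simp del: upt_Suc)
  have len: "length p = n"
    using p by (auto simp: permutations_of_set_def distinct_card[symmetric])
  have bound: "2 * w + m \<le> n" if twins: "has_weak_twins p w" for w
  proof -
    obtain f g where "twin_maps p n w f g"
      using twins by (auto simp: has_weak_twins_iff len)
    then have mono: "strict_mono_on {..<w} f" "strict_mono_on {..<w} g"
      and range: "\<And>k. k < w \<Longrightarrow> f k < n" "\<And>k. k < w \<Longrightarrow> g k < n"
      and disj: "f ` {..<w} \<inter> g ` {..<w} = {}"
      and shape: "\<And>k. Suc k < w \<Longrightarrow> p ! f k < p ! f (Suc k) \<longleftrightarrow> p ! g k < p ! g (Suc k)"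
      by (auto simp: twin_maps_def)
    have blk_mono: "blk (h k) \<le> blk (h l)"
      if "strict_mono_on {..<w} h" "\<And>k. k < w \<Longrightarrow> h k < n" "k \<le> l" "l < w" for h k l
      using that blk(2)[of "h k" "h l"] by (cases "k = l") (auto simp: strict_mono_on_def)
    show ?thesis
      unfolding n_def
    proof (rule block_counts_bound[of w "\<lambda>k. blk (f k)" "\<lambda>k. blk (g k)"])
      \<comment> \<open>In this permutation a step ascends exactly when it stays inside a
        block.\<close>
      show "blk (f k) = blk (f (Suc k)) \<longleftrightarrow> blk (g k) = blk (g (Suc k))" if "Suc k < w" for k
        using shape[OF that] blk(2)[of "f k" "f (Suc k)"] blk(2)[of "g k" "g (Suc k)"] range that mono
        by (simp add: strict_mono_on_def)
      show "card {k. k < w \<and> blk (f k) = b} + card {k. k < w \<and> blk (g k) = b} \<le> L b"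
        if "b \<le> m" for b
      proof -
        let ?F = "{k. k < w \<and> blk (f k) = b}" and ?G = "{k. k < w \<and> blk (g k) = b}"
        have inj: "inj_on f ?F" "inj_on g ?G"
          using mono[THEN strict_mono_on_imp_inj_on] by (auto intro: inj_on_subset)
        have "card ?F + card ?G = card (f ` ?F \<union> g ` ?G)"
          using disj inj by (subst card_Un_disjoint) (auto simp: card_image)
        also have "\<dots> \<le> card {i. i < n \<and> blk i = b}"
          using range by (intro card_mono) auto
        finally show ?thesis
          using blk(3)[OF that] by simp
      qed
    qed (use blk_mono mono range blk(1) odd gap in auto)
  qed
  then have "wt_perm p \<le> (n - m) div 2"
    unfolding wt_perm_le_iff by fastforce
  with p have le: "wt n \<le> (n - m) div 2"
    unfolding wt_le_iff by blast
  \<comment> \<open>The empty twins give this inequality, which makes the truncated subtraction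
    \<open>n - m\<close> exact.\<close>
  have "m \<le> n"
    using bound[OF has_weak_twins_0] by simp
  with le show ?thesis
    unfolding n_def by linarith
qed

text \<open>Blocks 1 to \<open>m\<close> have odd lengths descending to 1, and block 0 takes the
  rest. The factor 4 leaves block 0 longer than block 1 by at least \<open>m\<close>.\<close>

lemma wt_le_of_cube_le:
  assumes "4 * m ^ 3 \<le> n"
  shows "2 * wt n + m \<le> n"
proof -
  \<comment> \<open>The step \<open>2 * m\<close>, rather than \<open>m\<close>, keeps every length
    odd whatever the parity of \<open>m\<close>.\<close>
  define T where "T b = 2 * m * (m - b) + 1" for b
  define R where "R = (\<Sum>b<m. T (Suc b))"
  define L where "L b = (if b = 0 then n - R else T b)" for b
  have T1: "T 1 + m \<le> 2 * m ^ 2" if "0 < m"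
    using that by (cases m) (auto simp: T_def power2_eq_square)
  have "R \<le> (\<Sum>b<m. 2 * m ^ 2)"
    unfolding R_def
  proof (rule sum_mono)
    fix b assume "b \<in> {..<m}"
    then have "0 < m" by auto
    have "T (Suc b) \<le> T 1"
      by (simp add: T_def diff_le_mono2)
    also have "\<dots> \<le> 2 * m ^ 2"
      using T1[OF \<open>0 < m\<close>] by simp
    finally show "T (Suc b) \<le> 2 * m ^ 2" .
  qed
  then have R: "R \<le> 2 * m ^ 3"
    by (simp add: power2_eq_square power3_eq_cube mult_ac)
  \<comment> \<open>Half of \<open>4 * m ^ 3\<close> covers \<open>R\<close>; the other half covers
    \<open>T 1 + m\<close>, which is at most \<open>2 * m ^ 2\<close>.\<close>
  have first: "T 1 + m + R \<le> n" if "0 < m"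
  proof -
    have "m ^ 2 \<le> m ^ 3"
      using that by (intro power_increasing) auto
    then show ?thesis
      using T1[OF that] R assms by linarith
  qed
  have T_gap: "T b' + m \<le> T b" if "b < b'" "b' \<le> m" for b b'
  proof -
    have "2 * m * Suc (m - b') \<le> 2 * m * (m - b)"
      using that by (intro mult_le_mono2) linarith
    then show ?thesis
      by (simp add: T_def)
  qed
  have gap: "L b' + m \<le> L b" if "b < b'" "b' \<le> m" for b b'
  proof (cases "b = 0")
    case True
    have "T b' \<le> T 1"
      using that by (simp add: T_def)
    then show ?thesis
      using that True first by (simp add: L_def)
  qed (use that T_gap in \<open>simp add: L_def\<close>)
  have "(\<Sum>b\<le>m. L b) = n"
    using R assms by (simp add: sum.atMost_shift L_def R_def)
  moreover have "2 * wt (\<Sum>b\<le>m. L b) + m \<le> (\<Sum>b\<le>m. L b)"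
    by (rule wt_le_of_block_lengths) (use gap in \<open>auto simp: L_def T_def\<close>)
  ultimately show ?thesis
    by simp
qed

section \<open>Asymptotic form of the two bounds\<close>

theorem theorem1:
  shows "\<exists>c::real. c > 0 \<and>
    (\<forall>\<^sub>F n in sequentially.
       real n / 12 \<le> real (wt n) \<and>
       real (wt n) \<le> real n / 2 - c * real n powr (1/3))"
proof (intro exI[of _ "1/8"] conjI eventually_sequentiallyI[of 64])
  fix n :: nat assume n: "64 \<le> n"
  have "n \<le> 12 * (n div 4)"
    using n by linarith
  with wt_ge_div_4[of n] show "real n / 12 \<le> real (wt n)"
    by linarith
  define r where "r = real n powr (1/3)"
  have cube: "r ^ 3 = real n"
    using n by (simp add: r_def flip: powr_numeral add: powr_powr)
  have "4 \<le> r"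
  proof (rule power_le_imp_le_base)
    show "4 ^ Suc 2 \<le> r ^ Suc 2"
      using n cube by simp
  qed (simp add: r_def)
  \<comment> \<open>Then \<open>4 * m ^ 3\<close> is at most \<open>n / 2\<close>, and the loss
    \<open>m / 2\<close> exceeds \<open>r / 4 - 1 / 2\<close>. This is at least \<open>r / 8\<close>
    once \<open>4 \<le> r\<close>, whence the constant 1/8 and the threshold 64.\<close>
  define m where "m = nat \<lfloor>r / 2\<rfloor>"
  have m: "real m \<le> r / 2" "r / 2 < real m + 1"
    using \<open>4 \<le> r\<close> of_nat_floor[of "r / 2"] by (simp_all add: m_def)
  have "real m ^ 3 \<le> (r / 2) ^ 3"
    using m(1) by (intro power_mono) auto
  then have "real (4 * m ^ 3) \<le> real n"
    using cube by (simp add: power_divide)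
  then have "2 * wt n + m \<le> n"
    by (intro wt_le_of_cube_le) linarith
  then have "2 * real (wt n) + real m \<le> real n"
    by linarith
  then show "real (wt n) \<le> real n / 2 - 1/8 * real n powr (1/3)"
    using m(2) \<open>4 \<le> r\<close> by (fold r_def) linarith
qed simp

end
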